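(* Let $G$ be a connected weighted graph with vertex set $\{1,\dots,n\}$, where each edge weight is an $s\times s$ positive definite matrix. Let $L$ denote the Laplacian matrix of $G$ in which each edge weight matrix is replaced by its inverse. (i) If $H^1$ and $H^2$ are any two $g$-inverses of $L$, then $(e_{ij}\otimes I_s)^TH^1(e_{ij}\otimes I_s)=(e_{ij}\otimes I_s)^TH^2(e_{ij}\otimes I_s)$ for all distinct vertices $i,j$. (ii) If $G$ is a tree on $n$ vertices with distance matrix $D$, and $H$ is a $g$-inverse of $L$, then $H_{i,i}+H_{j,j}-H_{i,j}-H_{j,i}=D_{i,j}$ for all distinct vertices $i,j$.
   Context: Graphs are finite, simple and undirected. Matrices have real entries; positive definite matrices are symmetric. If $W_e$ is the weight of edge $e$, then $L$ is the $ns\times ns$ block matrix whose $(i,i)$ block is the sum of $W_e^{-1}$ over all edges $e$ incident with $i$, and whose $(i,j)$ block for $i\ne j$ is $-W_e^{-1}$ if $e=\{i,j\}$ is an edge and the zero matrix otherwise. A $g$-inverse (generalized inverse) of $A$ is a matrix $H$ with $AHA=A$. The vector $e_{ij}$ is the $n\times 1$ vector with $i$th coordinate $1$, $j$th coordinate $-1$ and zeros elsewhere. For an $ns\times ns$ matrix $B$ partitioned into $n\times n$ blocks of size $s\times s$, $B_{i,j}$ denotes the $(i,j)$ block. When $G$ is a tree, its distance matrix $D$ is the $ns\times ns$ block matrix whose block $D_{i,j}$ is the sum of the weight matrices of the edges on the unique path from $i$ to $j$ (so $D_{i,i}=0$). The Kronecker product is $A\otimes B=(a_{ij}B)$. *)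

theory Defs
  imports "HOL-Analysis.Analysis"
begin

text \<open>
  Vertices are the elements of a finite type \<open>'n\<close> (so the number of vertices is \<open>CARD('n)\<close>, the
  vertex set is \<open>UNIV\<close>, and a graph is given by its edge set). Edge weights are matrices indexed by
  a finite type \<open>'s\<close>. Rows and columns of a block matrix are indexed by \<open>'n \<times> 's\<close>: the index
  \<open>(i, a)\<close> is position \<open>a\<close> inside block \<open>i\<close>.
\<close>

section \<open>Finite simple undirected graphs\<close>

definition simple_graph :: "'n set set \<Rightarrow> bool" where
  "simple_graph E \<longleftrightarrow> (\<forall>e\<in>E. card e = 2)"

definition is_path :: "'n set set \<Rightarrow> 'n \<Rightarrow> 'n \<Rightarrow> 'n list \<Rightarrow> bool" where
  "is_path E u v p \<longleftrightarrow>
     p \<noteq> [] \<and> hd p = u \<and> last p = v \<and> distinct p \<and> successively (\<lambda>x y. {x, y} \<in> E) p"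

definition path_edges :: "'n list \<Rightarrow> 'n set set" where
  "path_edges p = {{p ! k, p ! Suc k} | k. Suc k < length p}"

definition connected_graph :: "'n set set \<Rightarrow> bool" where
  "connected_graph E \<longleftrightarrow> (\<forall>u v. \<exists>p. is_path E u v p)"

text \<open>A cycle is listed by its vertices without repeating the first one at the end.\<close>

definition is_cycle :: "'n set set \<Rightarrow> 'n list \<Rightarrow> bool" where
  "is_cycle E p \<longleftrightarrow>
     length p \<ge> 3 \<and> distinct p \<and> successively (\<lambda>x y. {x, y} \<in> E) p \<and> {last p, hd p} \<in> E"

definition is_tree :: "'n set set \<Rightarrow> bool" where
  "is_tree E \<longleftrightarrow> connected_graph E \<and> (\<nexists>p. is_cycle E p)"

section \<open>Matrices\<close>

definition positive_definite :: "real^'s^'s \<Rightarrow> bool" where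
  "positive_definite A \<longleftrightarrow> transpose A = A \<and> (\<forall>x. x \<noteq> 0 \<longrightarrow> x \<bullet> (A *v x) > 0)"

definition g_inverse :: "real^'b^'a \<Rightarrow> real^'a^'b \<Rightarrow> bool" where
  "g_inverse A H \<longleftrightarrow> A ** H ** A = A"

definition kronecker :: "real^'b^'a \<Rightarrow> real^'d^'c \<Rightarrow> real^('b \<times> 'd)^('a \<times> 'c)" where
  "kronecker A B = (\<chi> r c. A $ fst r $ fst c * B $ snd r $ snd c)"

definition block :: "real^('n::finite \<times> 's::finite)^('n \<times> 's) \<Rightarrow> 'n \<Rightarrow> 'n \<Rightarrow> real^'s^'s" where
  "block B i j = (\<chi> a b. B $ (i, a) $ (j, b))"

definition matrix_of_blocks :: "('n::finite \<Rightarrow> 'n \<Rightarrow> real^'s^'s) \<Rightarrow> real^('n \<times> 's)^('n \<times> 's)" where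
  "matrix_of_blocks F = (\<chi> r c. F (fst r) (fst c) $ snd r $ snd c)"

text \<open>The vector \<open>e\<^sub>i\<^sub>j\<close>, as a matrix with a single column.\<close>

definition e_vec :: "'n \<Rightarrow> 'n \<Rightarrow> real^1^'n" where
  "e_vec i j = (\<chi> k _. if k = i then 1 else if k = j then -1 else 0)"

section \<open>Laplacian and distance matrix\<close>

definition laplacian ::
  "'n::finite set set \<Rightarrow> ('n set \<Rightarrow> real^'s^'s) \<Rightarrow> real^('n \<times> 's)^('n \<times> 's)" where
  "laplacian E W = matrix_of_blocks (\<lambda>i j.
     if i = j then (\<Sum>e | e \<in> E \<and> i \<in> e. matrix_inv (W e))
     else if {i, j} \<in> E then - matrix_inv (W {i, j})
     else 0)"

text \<open>Meaningful only for trees, where the path between two vertices is unique.\<close>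

definition distance_matrix ::
  "'n::finite set set \<Rightarrow> ('n set \<Rightarrow> real^'s^'s) \<Rightarrow> real^('n \<times> 's)^('n \<times> 's)" where
  "distance_matrix E W = matrix_of_blocks (\<lambda>i j.
     \<Sum>e\<in>path_edges (THE p. is_path E i j p). W e)"

end

theory Submission
  imports Defs
begin

text \<open>
  Let \<open>\<delta> x\<close> be the block vector with \<open>x\<close> in block \<open>i\<close> and \<open>-x\<close> in block \<open>j\<close>. If \<open>L c = \<delta> x\<close> and \<open>L d = \<delta> y\<close>,
  then \<open>\<delta> y \<bullet> H \<delta> x = d \<bullet> L H L c = d \<bullet> L c = \<delta> y \<bullet> c = y \<bullet> (c\<^sub>i - c\<^sub>j)\<close> for every
  g-inverse \<open>H\<close>, which does not involve \<open>H\<close>. Such potentials \<open>c\<close> exist because the kernel of \<open>L\<close>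
  consists of the block-constant vectors. In a tree they are explicit: removing an edge \<open>{u, v}\<close>
  splits the vertices into two sides, and the vector equal to \<open>W x\<close> on the side of \<open>u\<close> and to \<open>0\<close> on
  the other one is a potential for \<open>{u, v}\<close>, with \<open>W\<close> the weight of that edge. Summing along the path
  from \<open>i\<close> to \<open>j\<close> gives \<open>c\<^sub>i - c\<^sub>j = D\<^sub>i\<^sub>j x\<close>.
\<close>

section \<open>Block vectors\<close>

lemma matrix_vector_mult_uminus_right: "(A :: real^'b::finite^'a) *v (- x) = - (A *v x)"
  by (simp add: matrix_vector_mult_def vec_eq_iff sum_negf)

lemma matrix_vector_mult_uminus_left: "(- A :: real^'b::finite^'a) *v x = - (A *v x)"
  by (simp add: matrix_vector_mult_def vec_eq_iff sum_negf)

lemma matrix_vector_mult_sum_left: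
  "(\<Sum>k\<in>K. A k) *v x = (\<Sum>k\<in>K. (A k :: real^'b::finite^'a) *v x)"
  by (induction K rule: infinite_finite_induct) (simp_all add: matrix_vector_mult_add_rdistrib)

definition vec_of_blocks :: "('n::finite \<Rightarrow> real^'s::finite) \<Rightarrow> real^('n \<times> 's)" where
  "vec_of_blocks f = (\<chi> r. f (fst r) $ snd r)"

lemma sum_UNIV_prod:
  "(\<Sum>r\<in>UNIV. g r) = (\<Sum>i\<in>UNIV. \<Sum>a\<in>UNIV. g (i, a))"
  by (simp add: sum.cartesian_product UNIV_Times_UNIV)

lemma ex_vec_of_blocks: "\<exists>f. v = vec_of_blocks f"
  by (rule exI[of _ "\<lambda>i. \<chi> a. v $ (i, a)"]) (simp add: vec_of_blocks_def vec_eq_iff)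

lemma vec_of_blocks_add: "vec_of_blocks f + vec_of_blocks g = vec_of_blocks (\<lambda>i. f i + g i)"
  by (simp add: vec_of_blocks_def vec_eq_iff)

lemma inner_vec_of_blocks:
  "vec_of_blocks f \<bullet> vec_of_blocks g = (\<Sum>i\<in>UNIV. f i \<bullet> g i)"
  by (simp add: vec_of_blocks_def inner_vec_def sum_UNIV_prod)

lemma mult_vec_of_blocks:
  "B *v vec_of_blocks f = vec_of_blocks (\<lambda>i. \<Sum>j\<in>UNIV. block B i j *v f j)"
  by (simp add: vec_of_blocks_def vec_eq_iff matrix_vector_mult_def block_def sum_UNIV_prod)

lemma block_matrix_of_blocks: "block (matrix_of_blocks F) i j = F i j"
  by (simp add: block_def matrix_of_blocks_def vec_eq_iff)

text \<open>For \<open>i \<noteq> j\<close> this is \<open>e_vec i j\<close> tensored with the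
  vector \<open>x\<close>. Being a difference, it vanishes for \<open>i = j\<close> and telescopes
  along paths.\<close>

definition dipole :: "'n \<Rightarrow> 'n \<Rightarrow> 'v::ab_group_add \<Rightarrow> 'n \<Rightarrow> 'v" where
  "dipole i j x k = (if k = i then x else 0) - (if k = j then x else 0)"

lemma dipole_same: "dipole i i x = (\<lambda>_. 0)"
  by (simp add: dipole_def fun_eq_iff)

lemma dipole_add: "dipole i j x k + dipole j l x k = dipole i l x k"
  by (simp add: dipole_def)

lemma inner_dipole:
  "vec_of_blocks (dipole i j x) \<bullet> vec_of_blocks f = x \<bullet> (f i - f j)"
proof -
  have "dipole i j x k \<bullet> f k = (if k = i then x \<bullet> f k else 0) - (if k = j then x \<bullet> f k else 0)" for k
    by (simp add: dipole_def inner_diff_left)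
  then show ?thesis
    by (simp add: inner_vec_of_blocks sum_subtractf inner_diff_right)
qed

text \<open>Pairing this with a second dipole by \<open>inner_dipole\<close> produces the four-block
  combination of part (ii).\<close>

lemma mult_dipole:
  "B *v vec_of_blocks (dipole i j x) = vec_of_blocks (\<lambda>k. (block B k i - block B k j) *v x)"
proof -
  have "block B k l *v dipole i j x l =
      (if l = i then block B k l *v x else 0) - (if l = j then block B k l *v x else 0)" for k l
    by (simp add: dipole_def matrix_vector_mult_diff_distrib)
  then show ?thesis
    by (simp add: mult_vec_of_blocks sum_subtractf matrix_vector_mult_diff_rdistrib)
qed

text \<open>The case \<open>i = j\<close> is excluded because \<open>e_vec i i\<close> has an entry
  1 while the dipole is zero.\<close>

lemma kronecker_e_vec_mult:
  assumes "i \<noteq> j"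
  shows "kronecker (e_vec i j) (mat 1 :: real^'s^'s) *v y =
         vec_of_blocks (dipole i j (\<chi> a. y $ (1, a)))"
proof -
  have "(\<Sum>a\<in>UNIV. z * (if b = a then 1 else 0) * y $ (1, a)) = z * y $ (1, b)" for z and b :: 's
  proof -
    have "z * (if b = a then 1 else 0) * y $ (1, a) = (if b = a then z * y $ (1, a) else 0)" for a
      by simp
    then show ?thesis by simp
  qed
  then show ?thesis
    using assms
    by (auto simp: kronecker_def e_vec_def mat_def vec_of_blocks_def dipole_def vec_eq_iff
        matrix_vector_mult_def sum_UNIV_prod UNIV_1)
qed

section \<open>Positive definite weights and the Laplacian\<close>

lemma positive_definite_matrix_inv:
  fixes A :: "real^'s::finite^'s"
  assumes "positive_definite A"
  shows "matrix_inv A ** A = mat 1" and "positive_definite (matrix_inv A)"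
proof -
  have sym: "transpose A = A" and pos: "\<And>x. x \<noteq> 0 \<Longrightarrow> x \<bullet> (A *v x) > 0"
    using assms by (auto simp: positive_definite_def)
  have "x = 0" if "A *v x = 0" for x
    using pos[of x] that by force
  then have "invertible A"
    by (simp add: invertible_left_inverse matrix_left_invertible_ker)
  then have "A ** matrix_inv A = mat 1 \<and> matrix_inv A ** A = mat 1"
    unfolding invertible_def matrix_inv_def by (rule someI_ex)
  then have right: "A ** matrix_inv A = mat 1"
    and left: "matrix_inv A ** A = mat 1"
    by auto
  show "matrix_inv A ** A = mat 1"
    by (fact left)
  \<comment> \<open>Symmetry of the inverse: insert \<open>A ** matrix_inv A\<close> and absorb the
    symmetric \<open>A\<close> into the transpose.\<close>
  have "transpose (matrix_inv A) = transpose (matrix_inv A) ** (A ** matrix_inv A)"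
    by (simp add: right)
  also have "\<dots> = transpose (A ** matrix_inv A) ** matrix_inv A"
    by (simp add: matrix_mul_assoc matrix_transpose_mul sym)
  also have "\<dots> = matrix_inv A"
    by (simp add: right)
  finally have "transpose (matrix_inv A) = matrix_inv A" .
  moreover have "x \<bullet> (matrix_inv A *v x) > 0" if "x \<noteq> 0" for x
  proof -
    \<comment> \<open>The form of the inverse at \<open>x = A *v y\<close> is the form of
      \<open>A\<close> at \<open>y\<close>.\<close>
    define y where "y = matrix_inv A *v x"
    have x: "x = A *v y"
      by (simp add: y_def matrix_vector_mul_assoc right)
    with that have "y \<noteq> 0" by auto
    then show ?thesis
      using pos[of y] by (simp add: y_def[symmetric]) (simp add: x inner_commute)
  qed
  ultimately show "positive_definite (matrix_inv A)"
    by (simp add: positive_definite_def)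
qed

lemma inner_symmetric_matrix:
  fixes A :: "real^'a::finite^'a"
  assumes "transpose A = A"
  shows "x \<bullet> (A *v y) = (A *v x) \<bullet> y"
  using dot_lmul_matrix[of x A y] assms by (metis transpose_matrix_vector)

lemma laplacian_mult_vec_of_blocks:
  assumes "simple_graph E"
  shows "laplacian E W *v vec_of_blocks f =
    vec_of_blocks (\<lambda>i. \<Sum>j | {i, j} \<in> E. matrix_inv (W {i, j}) *v (f i - f j))"
proof -
  have row: "(\<Sum>j\<in>UNIV. block (laplacian E W) i j *v f j)
      = (\<Sum>j | {i, j} \<in> E. matrix_inv (W {i, j}) *v (f i - f j))" for i
  proof -
    let ?N = "\<lambda>e. matrix_inv (W e)"
    have noloop: "{i} \<notin> E"
      using assms by (auto simp: simple_graph_def)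
    \<comment> \<open>Simplicity matches the neighbours of \<open>i\<close> with its incident edges,
      so the diagonal block becomes a sum over neighbours.\<close>
    have "bij_betw (\<lambda>j. {i, j}) {j. {i, j} \<in> E} {e \<in> E. i \<in> e}"
    proof (rule bij_betwI')
      fix e assume "e \<in> {e \<in> E. i \<in> e}"
      then have "card e = 2" "i \<in> e" "e \<in> E" using assms by (auto simp: simple_graph_def)
      then obtain x y where "e = {x, y}" by (auto simp: card_2_iff)
      with \<open>i \<in> e\<close> \<open>e \<in> E\<close> show "\<exists>j\<in>{j. {i, j} \<in> E}. e = {i, j}"
        by (auto simp: insert_commute)
    qed (auto simp: doubleton_eq_iff)
    then have diag: "(\<Sum>e | e \<in> E \<and> i \<in> e. ?N e) = (\<Sum>j | {i, j} \<in> E. ?N {i, j})"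
      by (simp add: sum.reindex_bij_betw[symmetric])
    \<comment> \<open>With no loops, the diagonal case and the edge case never overlap, so each term
      splits into a difference.\<close>
    have "block (laplacian E W) i j *v f j =
        (if j = i then (\<Sum>k | {i, k} \<in> E. ?N {i, k} *v f i) else 0)
        - (if {i, j} \<in> E then ?N {i, j} *v f j else 0)" for j
      using noloop
      by (auto simp: laplacian_def block_matrix_of_blocks diag matrix_vector_mult_sum_left matrix_vector_mult_uminus_left)
    then show ?thesis
      by (simp add: sum_subtractf matrix_vector_mult_diff_distrib sum.If_cases)
  qed
  show ?thesis
    by (simp add: mult_vec_of_blocks row)
qed

text \<open>This is the Dirichlet form of the graph; the sum runs over ordered pairs, so each edge
  counts twice, whence the factor 2.\<close>

lemma laplacian_form:
  assumes "simple_graph E"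
  shows "2 * (vec_of_blocks g \<bullet> (laplacian E W *v vec_of_blocks f)) =
    (\<Sum>i\<in>UNIV. \<Sum>j | {i, j} \<in> E. (g i - g j) \<bullet> (matrix_inv (W {i, j}) *v (f i - f j)))"
proof -
  let ?t = "\<lambda>h i j. if {i, j} \<in> E then h \<bullet> (matrix_inv (W {i, j}) *v (f i - f j)) else 0"
  have A: "vec_of_blocks g \<bullet> (laplacian E W *v vec_of_blocks f) = (\<Sum>i\<in>UNIV. \<Sum>j\<in>UNIV. ?t (g i) i j)"
    by (simp add: laplacian_mult_vec_of_blocks[OF assms] inner_vec_of_blocks inner_sum_right sum.If_cases)
  \<comment> \<open>Exchanging the endpoints keeps the weight and negates \<open>f i - f j\<close>;
    adding this expression to the original one yields \<open>g i - g j\<close>.\<close>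
  also have "\<dots> = (\<Sum>i\<in>UNIV. \<Sum>j\<in>UNIV. ?t (g j) j i)"
    by (rule sum.swap)
  also have "\<dots> = (\<Sum>i\<in>UNIV. \<Sum>j\<in>UNIV. - ?t (g j) i j)"
  proof (intro sum.cong refl)
    fix i j
    have "f j - f i = - (f i - f j)" by simp
    then show "?t (g j) j i = - ?t (g j) i j"
      by (simp only: insert_commute[of j i] matrix_vector_mult_uminus_right inner_minus_right) simp
  qed
  finally have B: "vec_of_blocks g \<bullet> (laplacian E W *v vec_of_blocks f) = \<dots>" .
  have "2 * (vec_of_blocks g \<bullet> (laplacian E W *v vec_of_blocks f)) =
      (\<Sum>i\<in>UNIV. \<Sum>j\<in>UNIV. ?t (g i) i j) + (\<Sum>i\<in>UNIV. \<Sum>j\<in>UNIV. - ?t (g j) i j)"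
    using A B by linarith
  also have "\<dots> = (\<Sum>i\<in>UNIV. \<Sum>j\<in>UNIV. ?t (g i - g j) i j)"
    unfolding sum.distrib[symmetric] by (intro sum.cong refl) (simp add: inner_diff_left)
  finally show ?thesis
    by (simp add: sum.If_cases)
qed

text \<open>The Dirichlet form is symmetric edge by edge, since each inverse weight is
  symmetric.\<close>

lemma laplacian_self_adjoint:
  assumes "simple_graph E" and "\<forall>e\<in>E. positive_definite (W e)"
  shows "u \<bullet> (laplacian E W *v v) = (laplacian E W *v u) \<bullet> v"
proof -
  obtain g f where uv: "u = vec_of_blocks g" "v = vec_of_blocks f"
    using ex_vec_of_blocks by metis
  have "x \<bullet> (matrix_inv (W e) *v y) = y \<bullet> (matrix_inv (W e) *v x)" if "e \<in> E" for e x y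
    using positive_definite_matrix_inv(2)[of "W e"] assms(2) that
    by (metis inner_symmetric_matrix positive_definite_def inner_commute)
  then have "2 * (u \<bullet> (laplacian E W *v v)) = 2 * (v \<bullet> (laplacian E W *v u))"
    unfolding uv laplacian_form[OF assms(1)] by (intro sum.cong refl) auto
  then show ?thesis by (simp add: inner_commute)
qed

section \<open>Paths\<close>

lemma path_edges_singleton [simp]: "path_edges [u] = {}"
  by (auto simp: path_edges_def)

lemma path_edges_Cons [simp]: "path_edges (u # v # q) = insert {u, v} (path_edges (v # q))"
proof -
  have "{k. Suc k < length (u # v # q)} = insert 0 (Suc ` {k. Suc k < length (v # q)})"
    by (auto simp: image_iff gr0_conv_Suc less_Suc_eq_0_disj)
  moreover have "path_edges p = (\<lambda>k. {p ! k, p ! Suc k}) ` {k. Suc k < length p}" for p :: "'a list"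
    by (auto simp: path_edges_def)
  ultimately show ?thesis
    by (simp add: image_image)
qed

lemma path_edges_subset_set: "e \<in> path_edges p \<Longrightarrow> e \<subseteq> set p"
  by (auto simp: path_edges_def)

lemma is_path_Cons:
  "is_path E u w (x # y # q) \<longleftrightarrow> x = u \<and> {u, y} \<in> E \<and> u \<notin> set (y # q) \<and> is_path E y w (y # q)"
  by (auto simp: is_path_def)

text \<open>Only edges on the path are tested, so \<open>c\<close> may jump elsewhere, as indicators
  of cuts and tree potentials do.\<close>

lemma constant_along_path:
  assumes "is_path E u v p"
    and "\<And>a b. {a, b} \<in> E \<Longrightarrow> {a, b} \<in> path_edges p \<Longrightarrow> c a = c b"
  shows "c u = c v"
  using assms
proof (induction p arbitrary: u rule: induct_list012)
  case (3 x y q)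
  then have "is_path E y v (y # q)" "x = u" "{u, y} \<in> E" by (auto simp: is_path_Cons)
  with 3 have "c y = c v" "c u = c y" by auto
  then show ?case by simp
qed (auto simp: is_path_def)

section \<open>Generalized inverses of the Laplacian\<close>

text \<open>A vanishing sum of nonnegative edge terms vanishes termwise; definiteness then equates
  \<open>f\<close> across each edge, and connectedness across the graph.\<close>

lemma laplacian_kernel:
  assumes "simple_graph E" "connected_graph E" "\<forall>e\<in>E. positive_definite (W e)"
    and "vec_of_blocks f \<bullet> (laplacian E W *v vec_of_blocks f) = 0"
  shows "f i = f j"
proof -
  let ?t = "\<lambda>i j. (f i - f j) \<bullet> (matrix_inv (W {i, j}) *v (f i - f j))"
  have pd: "positive_definite (matrix_inv (W e))" if "e \<in> E" for e
    using that assms(3) positive_definite_matrix_inv(2) by blast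
  have nonneg: "?t a b \<ge> 0" if "{a, b} \<in> E" for a b
    using pd[OF that] by (cases "f a = f b") (auto simp: positive_definite_def less_imp_le)
  have "(\<Sum>i\<in>UNIV. \<Sum>j | {i, j} \<in> E. ?t i j) = 0"
    using laplacian_form[OF assms(1), of f W f] assms(4) by simp
  then have "\<forall>a. (\<Sum>b | {a, b} \<in> E. ?t a b) = 0"
    by (subst (asm) sum_nonneg_eq_0_iff) (auto intro!: sum_nonneg nonneg)
  then have "\<forall>a b. {a, b} \<in> E \<longrightarrow> ?t a b = 0"
    by (subst (asm) sum_nonneg_eq_0_iff) (auto intro!: nonneg)
  then have "f a = f b" if "{a, b} \<in> E" for a b
    using pd[OF that] that unfolding positive_definite_def
    by (metis less_irrefl right_minus_eq)
  moreover obtain p where "is_path E i j p"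
    using assms(2) by (auto simp: connected_graph_def)
  ultimately show ?thesis
    using constant_along_path by metis
qed

text \<open>The range is its own double orthogonal complement, so it suffices that dipoles are
  orthogonal to everything orthogonal to the range.\<close>

lemma dipole_in_range_laplacian:
  assumes "simple_graph E" "connected_graph E" "\<forall>e\<in>E. positive_definite (W e)"
  shows "\<exists>c. laplacian E W *v vec_of_blocks c = vec_of_blocks (dipole i j x)"
proof -
  let ?R = "range ((*v) (laplacian E W))"
  have "vec_of_blocks (dipole i j x) \<bullet> y = 0" if "y \<in> orthogonal_comp ?R" for y
  proof -
    obtain f where y: "y = vec_of_blocks f" using ex_vec_of_blocks by metis
    \<comment> \<open>Orthogonality to the range includes orthogonality to the image of
      \<open>y\<close> itself, which makes \<open>y\<close> block-constant.\<close>
    have "y \<bullet> (laplacian E W *v y) = 0"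
      using that by (auto simp: orthogonal_comp_def orthogonal_def inner_commute)
    then have "f i = f j"
      using laplacian_kernel[OF assms] y by blast
    then show ?thesis by (simp add: y inner_dipole)
  qed
  then have "vec_of_blocks (dipole i j x) \<in> orthogonal_comp (orthogonal_comp ?R)"
    by (auto simp: orthogonal_comp_def[of "orthogonal_comp ?R"] orthogonal_def inner_commute)
  moreover have "subspace ?R"
    by (rule linear_subspace_image) auto
  ultimately have "vec_of_blocks (dipole i j x) \<in> ?R"
    by (simp add: orthogonal_comp_self)
  then show ?thesis
    using ex_vec_of_blocks by (metis imageE)
qed

lemma g_inverse_dipole_form:
  assumes "simple_graph E" "connected_graph E" "\<forall>e\<in>E. positive_definite (W e)"
    and "g_inverse (laplacian E W) H"
    and c: "laplacian E W *v vec_of_blocks c = vec_of_blocks (dipole i j x)"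
  shows "vec_of_blocks (dipole i j y) \<bullet> (H *v vec_of_blocks (dipole i j x)) = y \<bullet> (c i - c j)"
proof -
  let ?L = "laplacian E W"
  \<comment> \<open>The auxiliary \<open>d\<close> exposes a factor \<open>?L\<close> to the left of
    \<open>H\<close>; self-adjointness later removes it again.\<close>
  obtain d where d: "?L *v vec_of_blocks d = vec_of_blocks (dipole i j y)"
    using dipole_in_range_laplacian[OF assms(1-3)] by blast
  have "vec_of_blocks (dipole i j y) \<bullet> (H *v vec_of_blocks (dipole i j x))
      = vec_of_blocks d \<bullet> ((?L ** H ** ?L) *v vec_of_blocks c)"
    unfolding c[symmetric] d[symmetric] laplacian_self_adjoint[OF assms(1,3), symmetric]
    by (simp add: matrix_vector_mul_assoc matrix_mul_assoc)
  also have "\<dots> = (?L *v vec_of_blocks d) \<bullet> vec_of_blocks c"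
    using assms(4) laplacian_self_adjoint[OF assms(1,3)] by (simp add: g_inverse_def)
  finally show ?thesis
    by (simp add: d inner_dipole)
qed

section \<open>Trees\<close>

lemma rtrancl_is_path:
  assumes "(u, w) \<in> {(x, y). {x, y} \<in> E}\<^sup>*"
  shows "\<exists>p. is_path E u w p"
  using assms
proof (induction rule: rtrancl_induct)
  case base
  have "is_path E u u [u]" by (simp add: is_path_def)
  then show ?case ..
next
  case (step y z)
  then obtain p where p: "is_path E u y p" by blast
  show ?case
  proof (cases "z \<in> set p")
    case True
    \<comment> \<open>A revisited vertex closes a detour, so the path is truncated at the first
      visit.\<close>
    then obtain a b where "p = a @ z # b" by (meson split_list)
    then have "is_path E u y ((a @ [z]) @ b)" using p by simp
    then have "is_path E u z (a @ [z])"
      unfolding is_path_def successively_append_iff[of _ _ b] by (auto simp: hd_append)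
    then show ?thesis ..
  next
    case False
    with p step(2) have "is_path E u z (p @ [z])"
      by (auto simp: is_path_def successively_append_iff)
    then show ?thesis ..
  qed
qed

text \<open>Take for \<open>S\<close> the vertices reachable from \<open>u\<close> once the edge is
  deleted. Reaching \<open>v\<close> would close a cycle with that edge.\<close>

lemma tree_edge_cut:
  assumes "is_tree E" "simple_graph E" "{u, v} \<in> E"
  obtains S where "u \<in> S" "v \<notin> S"
    "\<And>a b. {a, b} \<in> E \<Longrightarrow> {a, b} \<noteq> {u, v} \<Longrightarrow> a \<in> S \<longleftrightarrow> b \<in> S"
proof -
  let ?E = "E - {{u, v}}"
  let ?R = "{(x, y). {x, y} \<in> ?E}"
  have "(u, v) \<notin> ?R\<^sup>*"
  proof
    assume "(u, v) \<in> ?R\<^sup>*"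
    then obtain p where p: "is_path ?E u v p" using rtrancl_is_path by metis
    have "u \<noteq> v" using assms(2,3) by (auto simp: simple_graph_def)
    then obtain y q where q: "p = u # y # q"
      using p by (cases p rule: remdups_adj.cases) (auto simp: is_path_def)
    \<comment> \<open>A path of two vertices would use the deleted edge itself;
      \<open>is_cycle\<close> demands at least three.\<close>
    have "q \<noteq> []" using p q by (auto simp: is_path_def)
    then have "length p \<ge> 3" using q by (cases q) auto
    moreover have "successively (\<lambda>x y. {x, y} \<in> E) p"
      using p by (auto simp: is_path_def elim: successively_mono)
    ultimately have "is_cycle E p"
      using p assms(3) by (auto simp: is_path_def is_cycle_def insert_commute)
    then show False using assms(1) by (auto simp: is_tree_def)
  qed
  moreover have step: "(u, b) \<in> ?R\<^sup>*" if "{a, b} \<in> E" "{a, b} \<noteq> {u, v}" "(u, a) \<in> ?R\<^sup>*" for a b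
    using that by (simp add: rtrancl_into_rtrancl)
  moreover have "(u, a) \<in> ?R\<^sup>* \<longleftrightarrow> (u, b) \<in> ?R\<^sup>*" if "{a, b} \<in> E" "{a, b} \<noteq> {u, v}" for a b
    using step[of a b] step[of b a] that by (simp only: insert_commute[of b a]) blast
  ultimately show ?thesis
    by (intro that[of "{w. (u, w) \<in> ?R\<^sup>*}"]) simp_all
qed

text \<open>Both paths must start with the same edge: past \<open>u\<close> each stays on the side
  of \<open>w\<close>, and only one edge crosses the cut.\<close>

lemma tree_path_unique:
  assumes "is_tree E" "simple_graph E" "is_path E u w p" "is_path E u w p'"
  shows "p = p'"
  using assms(3,4)
proof (induction p arbitrary: u p' rule: induct_list012)
  case 1
  then show ?case by (simp add: is_path_def)
next
  case (2 x)
  then show ?case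
    by (cases p' rule: remdups_adj.cases) (auto simp: is_path_def split: if_splits)
next
  case (3 x v q)
  then have p: "x = u" "{u, v} \<in> E" "u \<notin> set (v # q)" "is_path E v w (v # q)"
    by (auto simp: is_path_Cons)
  then have "w \<noteq> u" by (auto simp: is_path_def split: if_splits)
  then obtain v' q' where p': "p' = u # v' # q'"
    using "3.prems"(2) by (cases p' rule: remdups_adj.cases) (auto simp: is_path_def)
  with 3 have q': "{u, v'} \<in> E" "u \<notin> set (v' # q')" "is_path E v' w (v' # q')"
    by (auto simp: is_path_Cons)
  obtain S where S: "u \<in> S" "v \<notin> S"
    "\<And>a b. {a, b} \<in> E \<Longrightarrow> {a, b} \<noteq> {u, v} \<Longrightarrow> a \<in> S \<longleftrightarrow> b \<in> S"
    using tree_edge_cut[OF assms(1,2) p(2)] by metis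
  \<comment> \<open>The rest of the path avoids \<open>u\<close>, hence the cut edge, so it cannot
    change sides.\<close>
  have "v \<in> S \<longleftrightarrow> w \<in> S"
    by (rule constant_along_path[OF p(4)], rule S(3)) (use p(3) path_edges_subset_set in force)+
  moreover have "v' \<in> S \<longleftrightarrow> w \<in> S"
    by (rule constant_along_path[OF q'(3)], rule S(3)) (use q'(2) path_edges_subset_set in force)+
  ultimately have "v' = v"
    using S q'(1) by (auto simp: doubleton_eq_iff)
  with 3 p p' q' show ?case by auto
qed

lemma tree_edge_potential:
  fixes E :: "'n::finite set set" and W :: "'n set \<Rightarrow> real^'s::finite^'s"
  assumes "is_tree E" "simple_graph E" "\<forall>e\<in>E. positive_definite (W e)" "{u, v} \<in> E"
  obtains c where "laplacian E W *v vec_of_blocks c = vec_of_blocks (dipole u v x)"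
    "c u - c v = W {u, v} *v x"
    "\<And>a b. {a, b} \<in> E \<Longrightarrow> {a, b} \<noteq> {u, v} \<Longrightarrow> c a = c b"
proof -
  obtain S where S: "u \<in> S" "v \<notin> S"
    "\<And>a b. {a, b} \<in> E \<Longrightarrow> {a, b} \<noteq> {u, v} \<Longrightarrow> a \<in> S \<longleftrightarrow> b \<in> S"
    using tree_edge_cut[OF assms(1,2,4)] by metis
  \<comment> \<open>The jump \<open>W {u, v} *v x\<close> across the cut is chosen so that the
    inverse weight turns it into the flow \<open>x\<close>.\<close>
  define c where "c = (\<lambda>k. if k \<in> S then W {u, v} *v x else 0)"
  have c: "c a = c b" if "{a, b} \<in> E" "{a, b} \<noteq> {u, v}" for a b
    using S(3)[OF that] by (simp add: c_def)
  have "u \<noteq> v" using S by auto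
  have inv: "matrix_inv (W {u, v}) *v (W {u, v} *v x) = x"
    using assms(3,4) by (simp add: matrix_vector_mul_assoc positive_definite_matrix_inv(1))
  have "(\<Sum>j | {i, j} \<in> E. matrix_inv (W {i, j}) *v (c i - c j)) = dipole u v x i" for i
  proof -
    \<comment> \<open>Since \<open>c\<close> agrees across all other edges, only the cut edge
      contributes.\<close>
    have "(\<Sum>j | {i, j} \<in> E. matrix_inv (W {i, j}) *v (c i - c j))
        = (\<Sum>j | {i, j} = {u, v}. matrix_inv (W {i, j}) *v (c i - c j))"
      proof (intro sum.mono_neutral_right ballI)
      show "{j. {i, j} = {u, v}} \<subseteq> {j. {i, j} \<in> E}"
        using assms(4) by (simp add: Collect_mono_iff)
      fix j assume "j \<in> {j. {i, j} \<in> E} - {j. {i, j} = {u, v}}"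
      then have "c i = c j" using c[of i j] by blast
      then show "matrix_inv (W {i, j}) *v (c i - c j) = 0" by simp
    qed simp
    also have "\<dots> = dipole u v x i"
    proof -
      have "{j. {u, j} = {u, v}} = {v}" "{j. {v, j} = {u, v}} = {u}"
        by (auto simp: doubleton_eq_iff)
      moreover have "{j. {i, j} = {u, v}} = {}" if "i \<noteq> u" "i \<noteq> v"
        using that by (auto simp: doubleton_eq_iff)
      moreover have "0 - W {u, v} *v x = - (W {u, v} *v x)" by simp
      ultimately show ?thesis
        using \<open>u \<noteq> v\<close> S inv
        by (cases "i = u"; cases "i = v")
          (auto simp: dipole_def c_def insert_commute[of v u] matrix_vector_mult_uminus_right)
    qed
    finally show ?thesis .
  qed
  then have "laplacian E W *v vec_of_blocks c = vec_of_blocks (dipole u v x)"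
    by (simp add: laplacian_mult_vec_of_blocks[OF assms(2)])
  then show ?thesis
    using S(1,2) c by (intro that[of c]) (auto simp: c_def)
qed

text \<open>Edge potentials add up along the path. The last conjunct strengthens the induction: the
  potential of the tail must be constant across the first edge.\<close>

lemma tree_path_potential:
  fixes E :: "'n::finite set set" and W :: "'n set \<Rightarrow> real^'s::finite^'s"
  assumes "is_tree E" "simple_graph E" "\<forall>e\<in>E. positive_definite (W e)" "is_path E i j p"
  shows "\<exists>c. laplacian E W *v vec_of_blocks c = vec_of_blocks (dipole i j x)
    \<and> c i - c j = (\<Sum>e\<in>path_edges p. W e) *v x
    \<and> (\<forall>a b. {a, b} \<in> E \<longrightarrow> {a, b} \<notin> path_edges p \<longrightarrow> c a = c b)"
  using assms(4)
proof (induction p arbitrary: i rule: induct_list012)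
  case 1
  then show ?case by (simp add: is_path_def)
next
  case (2 u)
  then show ?case
    by (intro exI[of _ "\<lambda>_. 0"])
      (auto simp: is_path_def dipole_same laplacian_mult_vec_of_blocks[OF assms(2)])
next
  case (3 u v q)
  then have p: "u = i" "{i, v} \<in> E" "i \<notin> set (v # q)" "is_path E v j (v # q)"
    by (auto simp: is_path_Cons)
  \<comment> \<open>The first edge is fresh because its endpoint \<open>i\<close> is off the tail;
    this separates both the weight sums and the two potentials.\<close>
  then have new: "{i, v} \<notin> path_edges (v # q)"
    using path_edges_subset_set by force
  obtain c where c: "laplacian E W *v vec_of_blocks c = vec_of_blocks (dipole v j x)"
      "c v - c j = (\<Sum>e\<in>path_edges (v # q). W e) *v x"
      "\<And>a b. {a, b} \<in> E \<Longrightarrow> {a, b} \<notin> path_edges (v # q) \<Longrightarrow> c a = c b"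
    using "3.IH"(2)[OF p(4)] by metis
  obtain d where d: "laplacian E W *v vec_of_blocks d = vec_of_blocks (dipole i v x)"
      "d i - d v = W {i, v} *v x"
      "\<And>a b. {a, b} \<in> E \<Longrightarrow> {a, b} \<noteq> {i, v} \<Longrightarrow> d a = d b"
    using tree_edge_potential[OF assms(1-3) p(2)] by metis
  have "d v = d j"
    by (rule constant_along_path[OF p(4)], rule d(3)) (use new in auto)
  moreover have "c i = c v"
    using c(3) p(2) new by blast
  ultimately have "d i + c i - (d j + c j) = (d i - d v) + (c v - c j)"
    by simp
  then have "d i + c i - (d j + c j) = (\<Sum>e\<in>path_edges (i # v # q). W e) *v x"
    using new by (simp add: c(2) d(2) matrix_vector_mult_add_rdistrib)
  moreover have "laplacian E W *v vec_of_blocks (\<lambda>k. d k + c k) = vec_of_blocks (dipole i j x)"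
    by (simp add: vec_of_blocks_add[symmetric] matrix_vector_right_distrib c(1) d(1))
      (simp add: vec_of_blocks_add dipole_add)
  moreover have "d a + c a = d b + c b" if "{a, b} \<in> E" "{a, b} \<notin> path_edges (i # v # q)" for a b
    using that c(3)[of a b] d(3)[of a b] by simp
  ultimately show ?case
    unfolding p(1) by blast
qed

lemma block_distance_matrix:
  assumes "is_tree E" "simple_graph E" "is_path E i j p"
  shows "block (distance_matrix E W) i j = (\<Sum>e\<in>path_edges p. W e)"
proof -
  have "(THE p. is_path E i j p) = p"
    using assms(3) tree_path_unique[OF assms(1,2) _ assms(3)] by (rule the_equality)
  then show ?thesis
    by (simp add: distance_matrix_def block_matrix_of_blocks)
qed

theorem theorem3p4:
  fixes E :: "'n::finite set set"
    and W :: "'n set \<Rightarrow> real^'s::finite^'s"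
  assumes "simple_graph E"
    and "connected_graph E"
    and "\<forall>e\<in>E. positive_definite (W e)"
  shows "(\<forall>H1 H2. g_inverse (laplacian E W) H1 \<longrightarrow> g_inverse (laplacian E W) H2 \<longrightarrow>
           (\<forall>i j. i \<noteq> j \<longrightarrow>
              transpose (kronecker (e_vec i j) (mat 1 :: real^'s^'s)) ** H1
                ** kronecker (e_vec i j) (mat 1 :: real^'s^'s)
            = transpose (kronecker (e_vec i j) (mat 1 :: real^'s^'s)) ** H2
                ** kronecker (e_vec i j) (mat 1 :: real^'s^'s)))
       \<and> (is_tree E \<longrightarrow>
           (\<forall>H. g_inverse (laplacian E W) H \<longrightarrow>
              (\<forall>i j. i \<noteq> j \<longrightarrow>
                 block H i i + block H j j - block H i j - block H j i
               = block (distance_matrix E W) i j)))"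
proof (intro conjI allI impI)
  fix H1 H2 and i j :: 'n
  assume H: "g_inverse (laplacian E W) H1" "g_inverse (laplacian E W) H2" and "i \<noteq> j"
  let ?K = "kronecker (e_vec i j) (mat 1 :: real^'s^'s)"
  \<comment> \<open>The matrices are compared through their bilinear forms; one potential
    \<open>c\<close>, found from \<open>x\<close> alone, serves \<open>H1\<close> and
    \<open>H2\<close>.\<close>
  have "y \<bullet> ((transpose ?K ** H1 ** ?K) *v x) = y \<bullet> ((transpose ?K ** H2 ** ?K) *v x)" for x y
  proof -
    have form: "y \<bullet> ((transpose ?K ** H ** ?K) *v x) = (?K *v y) \<bullet> (H *v (?K *v x))" for H
      by (simp only: matrix_vector_mul_assoc[symmetric] dot_lmul_matrix[symmetric] vector_transpose_matrix)
    obtain c where "laplacian E W *v vec_of_blocks c = vec_of_blocks (dipole i j (\<chi> a. x $ (1, a)))"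
      using dipole_in_range_laplacian[OF assms] by metis
    then show ?thesis
      unfolding form kronecker_e_vec_mult[OF \<open>i \<noteq> j\<close>] by (simp add: g_inverse_dipole_form[OF assms] H)
  qed
  then show "transpose ?K ** H1 ** ?K = transpose ?K ** H2 ** ?K"
    unfolding matrix_eq by (intro allI) (rule vector_eq_ldot[THEN iffD1], rule allI)
next
  fix H and i j :: 'n
  assume "is_tree E" and H: "g_inverse (laplacian E W) H"
  obtain p where p: "is_path E i j p"
    using assms(2) by (auto simp: connected_graph_def)
  have "(block H i i + block H j j - block H i j - block H j i) *v x
      = block (distance_matrix E W) i j *v x" for x
  proof -
    obtain c where c: "laplacian E W *v vec_of_blocks c = vec_of_blocks (dipole i j x)"
        "c i - c j = (\<Sum>e\<in>path_edges p. W e) *v x"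
      using tree_path_potential[OF \<open>is_tree E\<close> assms(1,3) p] by blast
    \<comment> \<open>Both dipole products are expanded into blocks; the arbitrary \<open>y\<close>
      then lifts the scalar identity to vectors.\<close>
    have "y \<bullet> ((block H i i - block H i j) *v x - (block H j i - block H j j) *v x) = y \<bullet> (c i - c j)" for y
      using g_inverse_dipole_form[OF assms H c(1)] by (simp add: mult_dipole inner_dipole)
    then have "(block H i i - block H i j) *v x - (block H j i - block H j j) *v x = c i - c j"
      by (rule vector_eq_ldot[THEN iffD1, OF allI])
    also have "c i - c j = block (distance_matrix E W) i j *v x"
      unfolding c(2) block_distance_matrix[OF \<open>is_tree E\<close> assms(1) p] ..
    finally show ?thesis
      by (simp add: matrix_vector_mult_diff_rdistrib matrix_vector_mult_add_rdistrib algebra_simps)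
  qed
  then show "block H i i + block H j j - block H i j - block H j i = block (distance_matrix E W) i j"
    by (simp add: matrix_eq)
qed

end
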